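(* Let $r\ge 2$ and $t\ge 3$ be integers with $t\ge r$. Let $a$ be the smallest nonnegative integer for which $r'\leq \left\lfloor\frac{t'}{2}\right\rfloor +1$, where $r'=r-3a$ and $t'=t-3a$. Then $$\dim(K_r\times K_t)=\begin{cases} t+a-1, & \text{if } r'<\left\lfloor\frac{t'}{2}\right\rfloor+1 \text{ or } \left(r'=\frac{t'-1}{2}+1 \text{ and } t' \text{ is odd}\right),\\[4pt] t+a, & \text{if } r'=\frac{t'}{2}+1 \text{ and } t' \text{ is even.}\end{cases}$$
   Context: All graphs are finite and simple, and $d_G(x,y)$ is the number of edges of a shortest $x$–$y$ path in $G$. $K_n$ is the complete graph of order $n$. The direct product $G\times H$ has vertex set $V(G)\times V(H)$, with $(g,h)$ and $(g',h')$ adjacent if and only if $gg'\in E(G)$ and $hh'\in E(H)$. For a connected graph $G$, a vertex $w$ distinguishes two different vertices $u,v$ if $d_G(u,w)\neq d_G(v,w)$. A set $S\subset V(G)$ is a metric generator for $G$ if every pair of different vertices of $G$ is distinguished by some element of $S$. The metric dimension $\dim(G)$ is the smallest cardinality of a metric generator for $G$. *)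

theory Defs
  imports "Graph_Theory.Graph_Theory" "HOL-Library.Extended_Nat"
begin

text \<open>
  A finite simple graph is a \<^locale>\<open>pair_graph\<close>: finite, loop-free, with a symmetric
  arc set in which the edge \<open>uv\<close> is represented by the two arcs \<open>(u, v)\<close> and \<open>(v, u)\<close>.
\<close>

definition direct_product ::
  "'a pair_pre_digraph \<Rightarrow> 'b pair_pre_digraph \<Rightarrow> ('a \<times> 'b) pair_pre_digraph" where
  "direct_product G H =
     \<lparr> pverts = pverts G \<times> pverts H,
       parcs = {((g, h), (g', h')) | g h g' h'. (g, g') \<in> parcs G \<and> (h, h') \<in> parcs H} \<rparr>"

lemma pair_graph_direct_product:
  assumes "pair_graph G" "pair_graph H"
  shows "pair_graph (direct_product G H)"
proof -
  interpret G: pair_graph G by fact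
  interpret H: pair_graph H by fact
  have wf: "parcs (direct_product G H)
      \<subseteq> (pverts G \<times> pverts H) \<times> (pverts G \<times> pverts H)"
    by (auto simp: direct_product_def G.wellformed' H.wellformed')
  have fin: "finite (parcs (direct_product G H))"
    by (rule finite_subset[OF wf]) (simp add: G.pair_finite_verts H.pair_finite_verts)
  have "(y, x) \<in> parcs (direct_product G H)" if "(x, y) \<in> parcs (direct_product G H)" for x y
    using that G.pair_sym_arcs H.pair_sym_arcs
    by (auto simp: direct_product_def symmetric_def dest: symD)
  then have sym: "symmetric (with_proj (direct_product G H))"
    by (auto simp: symmetric_def intro: symI)
  have noloops: "fst e \<noteq> snd e" if "e \<in> parcs (direct_product G H)" for e
    using that G.pair_no_loops by (fastforce simp: direct_product_def)
  have fin_verts: "finite (pverts (direct_product G H))"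
    by (simp add: direct_product_def G.pair_finite_verts H.pair_finite_verts)
  have verts: "pverts (direct_product G H) = pverts G \<times> pverts H"
    by (simp add: direct_product_def)
  show ?thesis
    by unfold_locales (use wf fin sym noloops fin_verts verts in auto)
qed

text \<open>The distance is \<open>\<infinity>\<close> if there is no path at all.\<close>

definition graph_dist :: "'a pair_pre_digraph \<Rightarrow> 'a \<Rightarrow> 'a \<Rightarrow> enat" where
  "graph_dist G x y = (INF p \<in> {p. pre_digraph.apath (with_proj G) x p y}. enat (length p))"

definition distinguishes :: "'a pair_pre_digraph \<Rightarrow> 'a \<Rightarrow> 'a \<Rightarrow> 'a \<Rightarrow> bool" where
  "distinguishes G w u v \<longleftrightarrow> graph_dist G u w \<noteq> graph_dist G v w"

definition metric_generator :: "'a pair_pre_digraph \<Rightarrow> 'a set \<Rightarrow> bool" where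
  "metric_generator G S \<longleftrightarrow> S \<subseteq> pverts G \<and>
     (\<forall>u \<in> pverts G. \<forall>v \<in> pverts G. u \<noteq> v \<longrightarrow> (\<exists>w \<in> S. distinguishes G w u v))"

definition metric_dim :: "'a pair_pre_digraph \<Rightarrow> nat" where
  "metric_dim G = (LEAST n. \<exists>S. metric_generator G S \<and> card S = n)"

end

theory Submission
  imports Defs
begin

text \<open>
  A vertex of \<open>K\<^sub>r \<times> K\<^sub>t\<close> is a cell of an \<open>r \<times> t\<close> grid, and two cells are adjacent iff they lie in
  different rows and different columns. For \<open>r \<ge> 3\<close> distinct non-adjacent cells are at
  distance 2, so a cell \<open>w\<close> outside \<open>{u, v}\<close> distinguishes \<open>u\<close> from \<open>v\<close> iff it shares a line (row or
  column) with exactly one of them. Working this out, the metric generators are the sets \<open>S\<close> of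
  cells such that

  \<^item> at most one row and at most one column contain no cell of \<open>S\<close>;
  \<^item> at most one cell of \<open>S\<close> is isolated, that is, alone both in its row and in its column;
  \<^item> an isolated cell, an empty row and an empty column do not all occur.

  (Think of \<open>S\<close> as the edge set of a bipartite graph on rows and columns: isolated cells are the
  components with a single edge.) These conditions always suffice, by
  \<open>locating_imp_metric_generator\<close>, and for \<open>r \<ge> 3\<close> they are necessary, by
  \<open>metric_generator_imp_locating\<close>. That at most one column is empty is necessary for \<open>r = 2\<close> as
  well, although distances in \<open>K\<^sub>2 \<times> K\<^sub>t\<close> reach 3.

  It follows that \<open>dim (K\<^sub>r \<times> K\<^sub>t) = max (t - 1) \<lfloor>2 (r + t - 1) / 3\<rfloor>\<close> for \<open>r \<le> t\<close>. The
  bound \<open>t - 1\<close> holds because every cell lies in just one column and at most one column is empty. For the other bound, let each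
  cell give 2 to a line in which it is alone and 1 to a line which it shares. Every nonempty line
  receives at least 2, and a cell gives at most 3, or 4 if it is isolated; hence
  \<open>2 \<cdot> (number of nonempty lines) \<le> 3 |S| + (number of isolated cells)\<close>, and the three conditions
  turn this into \<open>2 (r + t) \<le> 3 |S| + 4\<close>. For \<open>r = 2\<close> the bound \<open>t - 1\<close> is the larger one.
  Equality is reached by leaving one row and one column empty and
  covering the remaining grid by pairs of cells in a common row or in a common column, plus as
  few extra cells as possible (\<open>star_cover_exists\<close>).

  Finally, \<open>r' \<le> \<lfloor>t'/2\<rfloor> + 1\<close> amounts to \<open>2 r \<le> t + 2 + 3 a\<close>, so that \<open>a\<close> is the least natural number
  that is at least \<open>(2 r - t - 2) / 3\<close>. The two cases of the theorem are strict inequality and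
  equality, and in both the maximum above evaluates to the stated value.
\<close>

section \<open>Small distances\<close>

lemma graph_dist_le:
  assumes "pre_digraph.apath (with_proj G) x p y"
  shows "graph_dist G x y \<le> enat (length p)"
  unfolding graph_dist_def using assms by (auto intro: INF_lower2)

lemma graph_dist_ge:
  assumes "\<And>p. pre_digraph.apath (with_proj G) x p y \<Longrightarrow> n \<le> length p"
  shows "enat n \<le> graph_dist G x y"
  unfolding graph_dist_def using assms by (auto intro!: INF_greatest)

context pair_graph
begin

lemma graph_dist_self:
  assumes "x \<in> pverts G"
  shows "graph_dist G x x = 0"
  using graph_dist_le[of G x "[]" x] assms by (simp add: apath_Nil_iff flip: zero_enat_def)

lemma graph_dist_ge_1:
  assumes "x \<noteq> y"
  shows "1 \<le> graph_dist G x y"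
proof -
  have "1 \<le> length p" if "apath x p y" for p
    using that assms by (cases p) (auto simp: apath_Nil_iff)
  from graph_dist_ge[OF this] show ?thesis by (simp add: one_enat_def)
qed

lemma graph_dist_adj:
  assumes "(x, y) \<in> parcs G"
  shows "graph_dist G x y = 1"
proof -
  have "x \<noteq> y" using assms no_loops' by blast
  then have "apath x [(x, y)] y"
    using assms by (auto simp: apath_Cons_iff apath_Nil_iff intro: wellformed')
  then have "graph_dist G x y \<le> 1"
    using graph_dist_le[of G x "[(x, y)]" y] by (simp add: one_enat_def)
  with graph_dist_ge_1[OF \<open>x \<noteq> y\<close>] show ?thesis by simp
qed

lemma graph_dist_ge_2:
  assumes "x \<noteq> y" "(x, y) \<notin> parcs G"
  shows "2 \<le> graph_dist G x y"
proof -
  have "2 \<le> length p" if "apath x p y" for p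
  proof (cases p)
    case Nil
    then show ?thesis using that assms by (auto simp: apath_Nil_iff)
  next
    case (Cons e es)
    then show ?thesis
      using that assms by (cases es) (auto simp: apath_Cons_iff apath_Nil_iff)
  qed
  from graph_dist_ge[OF this] show ?thesis by (simp add: numeral_eq_enat)
qed

lemma graph_dist_2:
  assumes "x \<noteq> y" "(x, y) \<notin> parcs G" "(x, z) \<in> parcs G" "(z, y) \<in> parcs G"
  shows "graph_dist G x y = 2"
proof -
  have "x \<noteq> z" "z \<noteq> y" using assms no_loops' by blast+
  then have "apath x [(x, z), (z, y)] y"
    using assms by (auto simp: apath_Cons_iff apath_Nil_iff intro: wellformed')
  then have "graph_dist G x y \<le> 2"
    using graph_dist_le[of G x "[(x, z), (z, y)]" y] by (simp add: numeral_eq_enat eval_nat_numeral)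
  with graph_dist_ge_2[OF assms(1,2)] show ?thesis by simp
qed

lemma graph_dist_eq_1_iff:
  assumes "x \<in> pverts G"
  shows "graph_dist G x y = 1 \<longleftrightarrow> (x, y) \<in> parcs G"
proof
  assume *: "graph_dist G x y = 1"
  then have "x \<noteq> y" using graph_dist_self[OF assms] by auto
  with * graph_dist_ge_2[of x y] show "(x, y) \<in> parcs G"
    by (metis one_less_numeral_iff not_le semiring_norm(76))
qed (rule graph_dist_adj)

end

section \<open>Metric generators as sets of cells in a grid\<close>

text \<open>
  A set of cells is also read as the edge set of a bipartite graph between rows and columns; an
  isolated cell is a component of that graph with exactly one edge.
\<close>

definition isolated_cell :: "('a \<times> 'b) set \<Rightarrow> 'a \<times> 'b \<Rightarrow> bool" where
  "isolated_cell S e \<longleftrightarrow> e \<in> S \<and> (\<forall>e' \<in> S. fst e' = fst e \<or> snd e' = snd e \<longrightarrow> e' = e)"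

text \<open>
  The combinatorial form of being a metric generator. It is equivalent for at least three rows and columns;
  for two rows it is stronger: two cells in different rows and columns generate
  \<open>K\<^sub>2 \<times> K\<^sub>3\<close>, which is a 6-cycle, although both are isolated.
\<close>

definition locating :: "'a set \<Rightarrow> 'b set \<Rightarrow> ('a \<times> 'b) set \<Rightarrow> bool" where
  "locating R C S \<longleftrightarrow> S \<subseteq> R \<times> C
     \<and> (\<forall>x \<in> R - fst ` S. \<forall>x' \<in> R - fst ` S. x = x')
     \<and> (\<forall>y \<in> C - snd ` S. \<forall>y' \<in> C - snd ` S. y = y')
     \<and> (\<forall>e e'. isolated_cell S e \<and> isolated_cell S e' \<longrightarrow> e = e')
     \<and> ((\<exists>e. isolated_cell S e) \<longrightarrow> R \<subseteq> fst ` S \<or> C \<subseteq> snd ` S)"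

locale complete_product =
  fixes G :: "'a pair_pre_digraph" and H :: "'b pair_pre_digraph" and r t :: nat
  assumes complete_G: "K\<^bsub>r\<^esub> (with_proj G)" and complete_H: "K\<^bsub>t\<^esub> (with_proj H)"
    and r_ge_2: "r \<ge> 2" and t_ge_3: "t \<ge> 3"
begin

abbreviation "R \<equiv> pverts G"
abbreviation "C \<equiv> pverts H"
abbreviation "P \<equiv> direct_product G H"

lemma finite_R: "finite R" and card_R: "card R = r"
  and finite_C: "finite C" and card_C: "card C = t"
  using complete_G complete_H by (auto simp: complete_digraph_pair_def)

lemma pverts_P: "pverts P = R \<times> C"
  by (simp add: direct_product_def)

lemma adj_iff:
  "((g, h), (g', h')) \<in> parcs P \<longleftrightarrow>
     g \<in> R \<and> g' \<in> R \<and> g \<noteq> g' \<and> h \<in> C \<and> h' \<in> C \<and> h \<noteq> h'"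
  using complete_G complete_H by (auto simp: complete_digraph_pair_def direct_product_def)

sublocale P: pair_graph P
  using complete_G complete_H
  by (intro pair_graph_direct_product pair_graphI_complete)

text \<open>
  The next two facts are all that is used about distances to show that a set is a generator. They
  avoid the diameter, which is 3 for \<open>r = 2\<close> and 2 otherwise.
\<close>

lemma not_distinguishes_adj:
  assumes "\<not> distinguishes P w u v" "u \<in> R \<times> C" "v \<in> R \<times> C"
  shows "(u, w) \<in> parcs P \<longleftrightarrow> (v, w) \<in> parcs P"
  using assms P.graph_dist_eq_1_iff[of u w] P.graph_dist_eq_1_iff[of v w]
  by (simp add: distinguishes_def pverts_P)

lemma not_distinguishes_neq:
  assumes "\<not> distinguishes P w u v" "u \<in> R \<times> C" "v \<in> R \<times> C" "u \<noteq> v"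
  shows "w \<noteq> u" "w \<noteq> v"
  using assms P.graph_dist_self[of u] P.graph_dist_self[of v]
    P.graph_dist_ge_1[of u v] P.graph_dist_ge_1[of v u]
  by (auto simp: distinguishes_def pverts_P)

text \<open>
  Suppose that no cell of \<open>S\<close> distinguishes \<open>u\<close> from \<open>v\<close>. If they share a line, then the two crossing
  lines through them are empty. Otherwise each of the other two corners of the rectangle that they
  span is an isolated cell or the crossing point of an empty row and an empty column. Both
  situations are excluded.
\<close>

lemma locating_imp_metric_generator:
  assumes "locating R C S"
  shows "metric_generator P S"
proof -
  have "\<exists>w \<in> S. distinguishes P w u v"
    if u: "u \<in> R \<times> C" and v: "v \<in> R \<times> C" and "u \<noteq> v" for u v
  proof (rule ccontr)
    assume none: "\<not> ?thesis"
    obtain g h g' h' where uv: "u = (g, h)" "v = (g', h')" by fastforce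
    have mem: "g \<in> R" "h \<in> C" "g' \<in> R" "h' \<in> C" using u v uv by auto
    have S_sub: "S \<subseteq> R \<times> C" using assms by (simp add: locating_def)
    have blind: "(x, y) \<noteq> (g, h)" "(x, y) \<noteq> (g', h')"
      "x = g \<or> y = h \<longleftrightarrow> x = g' \<or> y = h'" if "(x, y) \<in> S" for x y
      using that none not_distinguishes_neq[OF _ u v \<open>u \<noteq> v\<close>, of "(x, y)"]
        not_distinguishes_adj[OF _ u v, of "(x, y)"] S_sub mem
      by (auto simp: uv adj_iff)
    show False
    proof (cases "g = g' \<or> h = h'")
      case True
      have "g \<notin> fst ` S \<and> g' \<notin> fst ` S" if "g \<noteq> g'"
        using True that blind by force
      moreover have "h \<notin> snd ` S \<and> h' \<notin> snd ` S" if "h \<noteq> h'"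
        using True that blind by force
      ultimately show False
        using assms mem \<open>u \<noteq> v\<close> uv unfolding locating_def by blast
    next
      case False
      \<comment> \<open>\<open>u\<close> and \<open>v\<close> are opposite corners of a rectangle. A cell of \<open>S\<close> on a side
         through \<open>u\<close> must also lie on a side through \<open>v\<close>, so it is one of the other two corners.\<close>
      have only: "(x, y) = (g, h')" if "(x, y) \<in> S" "x = g \<or> y = h'" for x y
        using False blind[OF that(1)] that(2) by blast
      have only': "(x, y) = (g', h)" if "(x, y) \<in> S" "x = g' \<or> y = h" for x y
        using False blind[OF that(1)] that(2) by blast
      have corner: "isolated_cell S (g, h') \<or> g \<notin> fst ` S \<and> h' \<notin> snd ` S"
      proof (cases "(g, h') \<in> S")
        case True
        moreover have "e = (g, h')" if "e \<in> S" "fst e = g \<or> snd e = h'" for e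
          using only[of "fst e" "snd e"] that by simp
        ultimately show ?thesis unfolding isolated_cell_def fst_conv snd_conv by blast
      next
        case False
        then have "(g, y) \<notin> S" "(x, h') \<notin> S" for x y using only[of g y] only[of x h'] by auto
        then show ?thesis by force
      qed
      have corner': "isolated_cell S (g', h) \<or> g' \<notin> fst ` S \<and> h \<notin> snd ` S"
      proof (cases "(g', h) \<in> S")
        case True
        moreover have "e = (g', h)" if "e \<in> S" "fst e = g' \<or> snd e = h" for e
          using only'[of "fst e" "snd e"] that by simp
        ultimately show ?thesis unfolding isolated_cell_def fst_conv snd_conv by blast
      next
        case False
        then have "(g', y) \<notin> S" "(x, h) \<notin> S" for x y using only'[of g' y] only'[of x h] by auto
        then show ?thesis by force
      qed
      show False
        using corner corner' False assms mem unfolding locating_def by blast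
    qed
  qed
  then show ?thesis
    using assms by (auto simp: metric_generator_def pverts_P locating_def)
qed

lemma other_row: "\<exists>z \<in> R. z \<noteq> x"
proof (rule ccontr)
  assume "\<not> ?thesis"
  then have "card R \<le> card {x}" by (intro card_mono) auto
  then show False using card_R r_ge_2 by simp
qed

lemma other_column: "\<exists>z \<in> C. z \<noteq> y \<and> z \<noteq> y'"
proof (rule ccontr)
  assume "\<not> ?thesis"
  then have "card C \<le> card {y, y'}" by (intro card_mono) auto
  then show False using card_C t_ge_3 card_insert_le_m1[of 2 "{y'}" y] by simp
qed

lemma dist_same_row:
  assumes "x \<in> R" "y \<in> C" "y' \<in> C" "y \<noteq> y'"
  shows "graph_dist P (x, y) (x, y') = 2"
proof -
  obtain x' y'' where "x' \<in> R" "x' \<noteq> x" "y'' \<in> C" "y'' \<noteq> y" "y'' \<noteq> y'"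
    using other_row other_column by meson
  then show ?thesis
    using assms by (intro P.graph_dist_2[where z = "(x', y'')"]) (auto simp: adj_iff)
qed

lemma dist_same_column:
  assumes "r \<ge> 3" "x \<in> R" "x' \<in> R" "x \<noteq> x'" "y \<in> C"
  shows "graph_dist P (x, y) (x', y) = 2"
proof -
  have "\<exists>x'' \<in> R. x'' \<noteq> x \<and> x'' \<noteq> x'"
  proof (rule ccontr)
    assume "\<not> ?thesis"
    then have "card R \<le> card {x, x'}" by (intro card_mono) auto
    then show False using card_R \<open>r \<ge> 3\<close> card_insert_le_m1[of 2 "{x'}" x] by simp
  qed
  then obtain x'' y'' where "x'' \<in> R" "x'' \<noteq> x" "x'' \<noteq> x'" "y'' \<in> C" "y'' \<noteq> y"
    using other_column by meson
  then show ?thesis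
    using assms by (intro P.graph_dist_2[where z = "(x'', y'')"]) (auto simp: adj_iff)
qed

lemma dist_eq_if:
  assumes "r \<ge> 3" "u \<in> R \<times> C" "w \<in> R \<times> C" "u \<noteq> w"
  shows "graph_dist P u w = (if fst u = fst w \<or> snd u = snd w then 2 else 1)"
  using assms dist_same_row dist_same_column P.graph_dist_adj
  by (cases u; cases w) (auto simp: adj_iff)

text \<open>
  A cell outside the columns \<open>y\<close> and \<open>y'\<close> has the same distance to \<open>(g, y)\<close> and \<open>(g, y')\<close>. As distances
  within a row are 2 even when there are only two rows, this covers \<open>r = 2\<close> too.
\<close>

lemma generator_uncovered_column:
  assumes "metric_generator P S" "y \<in> C - snd ` S" "y' \<in> C - snd ` S"
  shows "y = y'"
proof (rule ccontr)
  assume "y \<noteq> y'"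
  obtain g where "g \<in> R" using other_row by blast
  then obtain w where "w \<in> S" and d: "distinguishes P w (g, y) (g, y')"
    using assms \<open>y \<noteq> y'\<close> unfolding metric_generator_def pverts_P
    by (metis (no_types, lifting) DiffD1 SigmaI prod.inject)
  obtain x z where w: "w = (x, z)" by fastforce
  have "x \<in> R" "z \<in> C" "z \<noteq> y" "z \<noteq> y'"
    using \<open>w \<in> S\<close> w assms by (force simp: metric_generator_def pverts_P)+
  moreover have "graph_dist P (g, b) (x, z) = (if x = g then 2 else 1)"
    if "b \<in> C" "z \<noteq> b" for b
    using that \<open>g \<in> R\<close> \<open>x \<in> R\<close> \<open>z \<in> C\<close> dist_same_row P.graph_dist_adj by (auto simp: adj_iff)
  ultimately show False using d w assms by (simp add: distinguishes_def)
qed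

text \<open>
  Each forbidden configuration yields a pair of cells that \<open>S\<close> cannot tell apart. Two isolated cells
  \<open>(g, h')\<close> and \<open>(g', h)\<close> are invisible to the pair \<open>(g, h)\<close>, \<open>(g', h')\<close>, since each of them shares a line
  with both members of the pair and no other cell shares a line with either; an empty row \<open>g'\<close> together with an empty column \<open>h\<close> can take the
  place of the second isolated cell.
\<close>

lemma metric_generator_imp_locating:
  assumes "r \<ge> 3" and gen: "metric_generator P S"
  shows "locating R C S"
proof -
  have S_sub: "S \<subseteq> R \<times> C" using gen by (simp add: metric_generator_def pverts_P)
  have blind: "(g, h) = (g', h')"
    if mem: "g \<in> R" "h \<in> C" "g' \<in> R" "h' \<in> C"
      and same: "\<And>x y. (x, y) \<in> S \<Longrightarrow> (x, y) \<noteq> (g, h) \<and> (x, y) \<noteq> (g', h')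
        \<and> (x = g \<or> y = h \<longleftrightarrow> x = g' \<or> y = h')" for g h g' h'
  proof (rule ccontr)
    assume "(g, h) \<noteq> (g', h')"
    then obtain w where "w \<in> S" and d: "distinguishes P w (g, h) (g', h')"
      using gen mem unfolding metric_generator_def pverts_P by blast
    obtain x y where w: "w = (x, y)" by fastforce
    have "(x, y) \<in> R \<times> C" using \<open>w \<in> S\<close> w S_sub by auto
    then have "graph_dist P (g, h) w = graph_dist P (g', h') w"
      using same[of x y] \<open>w \<in> S\<close> w mem dist_eq_if[OF \<open>r \<ge> 3\<close>, of "(g, h)" w]
        dist_eq_if[OF \<open>r \<ge> 3\<close>, of "(g', h')" w]
      by (cases "x = g \<or> y = h") auto
    with d show False by (simp add: distinguishes_def)
  qed
  have rows: "x = x'" if un: "x \<in> R - fst ` S" "x' \<in> R - fst ` S" for x x'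
  proof -
    obtain h where h: "h \<in> C" using other_column by blast
    have "(x, y) \<notin> S" "(x', y) \<notin> S" for y using un by (auto intro: rev_image_eqI)
    then have "(x, h) = (x', h)" using un h by (intro blind) auto
    then show ?thesis by simp
  qed
  have alone: "a = g \<and> b = h" if "isolated_cell S (g, h)" "(a, b) \<in> S" "a = g \<or> b = h" for a b g h
    using that unfolding isolated_cell_def by fastforce
  have isolated: "e = e'" if iso: "isolated_cell S e" "isolated_cell S e'" for e e'
  proof (rule ccontr)
    assume "e \<noteq> e'"
    obtain g h g' h' where e: "e = (g, h')" "e' = (g', h)" by fastforce
    note iso' = iso[unfolded e]
    have mem: "(g, h') \<in> S" "(g', h) \<in> S" using iso' by (simp_all add: isolated_cell_def)
    have neq: "g \<noteq> g'" "h \<noteq> h'"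
      using alone[OF iso'(1) mem(2)] \<open>e \<noteq> e'\<close> unfolding e by blast+
    have "(g, h) = (g', h')"
      using mem neq S_sub alone[OF iso'(1)] alone[OF iso'(2)] by (intro blind) blast+
    with neq show False by simp
  qed
  have full: "R \<subseteq> fst ` S \<or> C \<subseteq> snd ` S" if iso: "isolated_cell S e" for e
  proof (rule ccontr)
    assume "\<not> ?thesis"
    then obtain g' h where "g' \<in> R" "h \<in> C" "g' \<notin> fst ` S" "h \<notin> snd ` S" by blast
    then have un: "g' \<in> R" "h \<in> C" "\<And>y. (g', y) \<notin> S" "\<And>x. (x, h) \<notin> S"
      by (auto intro: rev_image_eqI)
    obtain g h' where e: "e = (g, h')" by fastforce
    note iso' = iso[unfolded e]
    have mem: "(g, h') \<in> S" using iso' by (simp add: isolated_cell_def)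
    then have neq: "g \<noteq> g'" "h \<noteq> h'" using un by blast+
    have "(g, h) = (g', h')"
      using mem neq S_sub un alone[OF iso'] by (intro blind) blast+
    with neq show False by simp
  qed
  show ?thesis
    unfolding locating_def using S_sub rows generator_uncovered_column[OF gen] isolated full
    by (intro conjI ballI allI impI) (assumption | blast)+
qed

end

section \<open>Counting cells\<close>

text \<open>
  A fibre of \<open>f\<close> with a single element has weight 2, and the weight of a larger fibre is its size, so every nonempty fibre weighs at least 2.
\<close>

lemma double_card_image_le:
  assumes "finite S"
  shows "2 * card (f ` S) \<le> (\<Sum>e\<in>S. if \<forall>e'\<in>S. f e' = f e \<longrightarrow> e' = e then 2 else 1 :: nat)"
    (is "_ \<le> sum ?w S")
proof -
  have "2 \<le> sum ?w {e \<in> S. f e = y}" if y: "y \<in> f ` S" for y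
  proof -
    obtain e where e: "e \<in> S" "f e = y" using y by blast
    show ?thesis
    proof (cases "\<forall>e' \<in> S. f e' = y \<longrightarrow> e' = e")
      case True
      then have "{e \<in> S. f e = y} = {e}" using e by blast
      moreover have "?w e = 2" using True e(2) by (intro if_P) blast
      ultimately show ?thesis by simp
    next
      case False
      then obtain e' where e': "e' \<in> S" "f e' = y" "e' \<noteq> e" by blast
      have "2 = card {e, e'}" using e' by simp
      also have "\<dots> \<le> card {e \<in> S. f e = y}" using e e' assms by (intro card_mono) auto
      also have "\<dots> = sum (\<lambda>_. 1) {e \<in> S. f e = y}" by simp
      also have "\<dots> \<le> sum ?w {e \<in> S. f e = y}" by (intro sum_mono) auto
      finally show ?thesis .
    qed
  qed
  then have "(\<Sum>y \<in> f ` S. 2) \<le> (\<Sum>y \<in> f ` S. sum ?w {e \<in> S. f e = y})"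
    by (intro sum_mono)
  also have "\<dots> = sum ?w S" by (rule sum.image_gen[symmetric, OF assms])
  finally show ?thesis by simp
qed

text \<open>
  The charging argument: the row weight and the column weight of a cell add up to at most 3, with
  the exception of an isolated cell, for which they add up to 4.
\<close>

lemma double_card_lines_le:
  assumes "finite S"
  shows "2 * (card (fst ` S) + card (snd ` S)) \<le> 3 * card S + card (Collect (isolated_cell S))"
proof -
  let ?w = "\<lambda>f e. if \<forall>e'\<in>S. f e' = f e \<longrightarrow> e' = e then 2 else 1 :: nat"
  have "?w fst e + ?w snd e \<le> 3 + (if isolated_cell S e then 1 else 0)" if "e \<in> S" for e
    using that unfolding isolated_cell_def by (auto split: if_splits)
  then have "(\<Sum>e\<in>S. ?w fst e + ?w snd e) \<le> (\<Sum>e\<in>S. 3 + (if isolated_cell S e then 1 else 0))"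
    by (rule sum_mono)
  also have "\<dots> = 3 * card S + card {e \<in> S. isolated_cell S e}"
    using assms by (simp only: sum.distrib sum.If_cases) (simp add: Int_def)
  also have "{e \<in> S. isolated_cell S e} = Collect (isolated_cell S)"
    unfolding isolated_cell_def by blast
  finally have "sum (?w fst) S + sum (?w snd) S \<le> 3 * card S + card (Collect (isolated_cell S))"
    by (simp only: sum.distrib)
  with add_mono[OF double_card_image_le double_card_image_le, OF assms assms, of fst snd]
  show ?thesis by (simp only: add_mult_distrib2)
qed

lemma card_le_1_if_unique:
  assumes "\<And>x y. x \<in> A \<Longrightarrow> y \<in> A \<Longrightarrow> x = y"
  shows "card A \<le> 1"
  using assms by (cases "finite A") (auto simp: card_le_Suc0_iff_eq)

text \<open>
  Empty lines cost 2 each and isolated cells 1 each in the charging bound. A locating set has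
  either at most two empty lines and no isolated cell, or at most one of each, so the total
  loss is at most 4.
\<close>

lemma locating_card_ge:
  assumes "finite R" "finite C" "locating R C S"
  shows "2 * (card R + card C) \<le> 3 * card S + 4"
proof -
  have S_sub: "S \<subseteq> R \<times> C" using assms by (simp add: locating_def)
  then have fin: "finite S" using assms finite_subset by blast
  have sub: "fst ` S \<subseteq> R" "snd ` S \<subseteq> C" using S_sub by auto
  have R: "card R = card (fst ` S) + card (R - fst ` S)"
    using card_Int_Diff[OF \<open>finite R\<close>, of "fst ` S"] sub by (simp add: Int_absorb1)
  have C: "card C = card (snd ` S) + card (C - snd ` S)"
    using card_Int_Diff[OF \<open>finite C\<close>, of "snd ` S"] sub by (simp add: Int_absorb1)
  have "card (R - fst ` S) \<le> 1" "card (C - snd ` S) \<le> 1" "card (Collect (isolated_cell S)) \<le> 1"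
    using assms(3) unfolding locating_def by (intro card_le_1_if_unique; blast)+
  moreover have "card (R - fst ` S) = 0 \<or> card (C - snd ` S) = 0 \<or> card (Collect (isolated_cell S)) = 0"
  proof (cases "\<exists>e. isolated_cell S e")
    case True
    then have "R - fst ` S = {} \<or> C - snd ` S = {}"
      using assms unfolding locating_def by blast
    then show ?thesis by (metis card.empty)
  next
    case False
    then have "Collect (isolated_cell S) = {}" by blast
    then show ?thesis by (simp only: card.empty simp_thms)
  qed
  ultimately show ?thesis using double_card_lines_le[OF fin] R C by auto
qed

lemma (in complete_product) metric_generator_card_ge:
  assumes "metric_generator P S"
  shows "t - 1 \<le> card S" "r \<ge> 3 \<Longrightarrow> 2 * (r + t) \<le> 3 * card S + 4"
proof -
  have S_sub: "S \<subseteq> R \<times> C" using assms by (simp add: metric_generator_def pverts_P)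
  then have fin: "finite S" using finite_R finite_C finite_subset by blast
  have "card (C - snd ` S) \<le> 1"
    using generator_uncovered_column[OF assms] by (intro card_le_1_if_unique)
  moreover have "card C - card (snd ` S) \<le> card (C - snd ` S)"
    using fin by (intro diff_card_le_card_Diff) auto
  ultimately show "t - 1 \<le> card S"
    using card_image_le[OF fin, of snd] card_C by linarith
  show "2 * (r + t) \<le> 3 * card S + 4" if "r \<ge> 3"
    using locating_card_ge[OF finite_R finite_C metric_generator_imp_locating[OF that assms]]
    by (simp add: card_R card_C)
qed

section \<open>Covering a grid by stars\<close>

text \<open>
  The name refers to the typical components of the covers built here: a star consists of at
  least two cells in a common line.
\<close>

definition star_cover :: "'a set \<Rightarrow> 'b set \<Rightarrow> nat \<Rightarrow> bool" where
  "star_cover A B m \<longleftrightarrow> (\<exists>S. finite S \<and> fst ` S = A \<and> snd ` S = B \<and> card S = m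
     \<and> (\<forall>e. \<not> isolated_cell S e))"

lemma star_cover_empty: "star_cover {} {} 0"
  unfolding star_cover_def isolated_cell_def by (intro exI[of _ "{}"]) simp

lemma star_cover_Un:
  assumes "star_cover A B m" "star_cover A' B' m'" "A \<inter> A' = {}"
  shows "star_cover (A \<union> A') (B \<union> B') (m + m')"
proof -
  obtain S where
    S: "finite S" "fst ` S = A" "snd ` S = B" "card S = m" "\<And>e. \<not> isolated_cell S e"
    using assms(1) unfolding star_cover_def by blast
  obtain S' where
    S': "finite S'" "fst ` S' = A'" "snd ` S' = B'" "card S' = m'" "\<And>e. \<not> isolated_cell S' e"
    using assms(2) unfolding star_cover_def by blast
  have "S \<inter> S' = {}" using S S' assms by blast
  moreover have "\<not> isolated_cell (S \<union> S') e" for e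
    using S(5)[of e] S'(5)[of e] unfolding isolated_cell_def by blast
  ultimately show ?thesis
    unfolding star_cover_def using S S'
    by (intro exI[of _ "S \<union> S'"]) (auto simp: card_Un_disjoint image_Un)
qed

lemma star_cover_row_star: "y \<noteq> y' \<Longrightarrow> star_cover {x} {y, y'} 2"
  unfolding star_cover_def isolated_cell_def by (intro exI[of _ "{(x, y), (x, y')}"]) auto

lemma star_cover_column_star: "x \<noteq> x' \<Longrightarrow> star_cover {x, x'} {y} 2"
  unfolding star_cover_def isolated_cell_def by (intro exI[of _ "{(x, y), (x', y)}"]) auto

lemma star_cover_add_cell:
  assumes "star_cover A B m" "x \<in> A \<and> y \<notin> B \<or> x \<notin> A \<and> y \<in> B"
  shows "star_cover (insert x A) (insert y B) (Suc m)"
proof -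
  obtain S where
    S: "finite S" "fst ` S = A" "snd ` S = B" "card S = m" "\<And>e. \<not> isolated_cell S e"
    using assms(1) unfolding star_cover_def by blast
  have new: "(x, y) \<notin> S"
    using assms(2) imageI[of "(x, y)" S fst] imageI[of "(x, y)" S snd] S(2,3) by auto
  have "x \<in> fst ` S \<or> y \<in> snd ` S" using assms(2) S(2,3) by blast
  then have "\<exists>e \<in> S. fst e = x \<or> snd e = y" by blast
  then have "\<not> isolated_cell (insert (x, y) S) e" for e
    using S(5)[of e] new unfolding isolated_cell_def by (cases "e = (x, y)") auto
  then show ?thesis
    unfolding star_cover_def using S new by (intro exI[of _ "insert (x, y) S"]) auto
qed

text \<open>
  Covers are now assembled from \<open>i\<close> pairs of cells in a common row (each using one row and two
  columns), \<open>j\<close> pairs in a common column (two rows and one column), and \<open>k\<close> extra rows and \<open>l\<close> extra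
  columns, each attached by one more cell to a line that is already covered.
\<close>

lemma star_cover_row_stars:
  assumes "finite A" "finite B" "card A = i" "card B = 2 * i"
  shows "star_cover A B (2 * i)"
  using assms
proof (induction i arbitrary: A B)
  case 0
  then show ?case by (simp add: star_cover_empty)
next
  case (Suc i)
  obtain x A' where A: "A = insert x A'" "x \<notin> A'" "card A' = i"
    using Suc.prems by (metis card_Suc_eq)
  have "card B = Suc (Suc (2 * i))" using Suc.prems by simp
  then obtain y y' B' where B: "B = insert y (insert y' B')" "y \<notin> insert y' B'" "y' \<notin> B'"
    "card B' = 2 * i"
    by (metis card_Suc_eq)
  have "star_cover A' B' (2 * i)" using Suc A B by simp
  from star_cover_Un[OF star_cover_row_star[of y y' x] this] show ?case
    using A B by simp
qed

lemma star_cover_stars: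
  assumes "finite A" "finite B" "card A = i + 2 * j" "card B = 2 * i + j"
  shows "star_cover A B (2 * i + 2 * j)"
  using assms
proof (induction j arbitrary: A B)
  case 0
  then show ?case by (simp add: star_cover_row_stars)
next
  case (Suc j)
  have "card B = Suc (2 * i + j)" using Suc.prems by simp
  then obtain y B' where B: "B = insert y B'" "y \<notin> B'" "card B' = 2 * i + j"
    by (metis card_Suc_eq)
  have "card A = Suc (Suc (i + 2 * j))" using Suc.prems by simp
  then obtain x x' A' where A: "A = insert x (insert x' A')" "x \<notin> insert x' A'" "x' \<notin> A'"
    "card A' = i + 2 * j"
    by (metis card_Suc_eq)
  have "star_cover A' B' (2 * i + 2 * j)" using Suc A B by simp
  from star_cover_Un[OF star_cover_column_star[of x x' y] this] show ?case
    using A B by simp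
qed

lemma star_cover_stars_columns:
  assumes "finite A" "finite B" "card A = i + 2 * j" "card B = 2 * i + j + l" "i + j \<ge> 1"
  shows "star_cover A B (2 * i + 2 * j + l)"
  using assms
proof (induction l arbitrary: B)
  case 0
  then show ?case by (simp add: star_cover_stars)
next
  case (Suc l)
  have "card B = Suc (2 * i + j + l)" using Suc.prems by simp
  then obtain y B' where B: "B = insert y B'" "y \<notin> B'" "card B' = 2 * i + j + l"
    by (metis card_Suc_eq)
  obtain x where x: "x \<in> A" using Suc.prems by fastforce
  have "star_cover A B' (2 * i + 2 * j + l)" using Suc B by simp
  from star_cover_add_cell[OF this, of x y] show ?case
    using x B by (simp add: insert_absorb)
qed

lemma star_cover_stars_rows_columns:
  assumes "finite A" "finite B" "card A = i + 2 * j + k" "card B = 2 * i + j + l" "i + j \<ge> 1"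
  shows "star_cover A B (2 * i + 2 * j + k + l)"
  using assms
proof (induction k arbitrary: A)
  case 0
  then show ?case by (simp add: star_cover_stars_columns)
next
  case (Suc k)
  have "card A = Suc (i + 2 * j + k)" using Suc.prems by simp
  then obtain x A' where A: "A = insert x A'" "x \<notin> A'" "card A' = i + 2 * j + k"
    by (metis card_Suc_eq)
  obtain y where y: "y \<in> B" using Suc.prems by fastforce
  have "star_cover A' B (2 * i + 2 * j + k + l)" using Suc A by simp
  from star_cover_add_cell[OF this, of x y] show ?case
    using y A by (simp add: insert_absorb)
qed

text \<open>
  For \<open>p \<le> q\<close> the numbers of pairs come from solving \<open>i + 2 j = p\<close>, \<open>2 i + j = q\<close>. If \<open>q \<ge> 2 p\<close>, take
  one pair in each row and attach the remaining columns. Otherwise let \<open>c = \<lfloor>(p + q) / 3\<rfloor>\<close> be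
  the number of pairs; a remainder of \<open>p + q\<close> modulo 3 is absorbed by first removing a
  column, or a column and a row, and attaching them again at the end. The condition \<open>q \<ge> 2\<close>
  excludes the \<open>1 \<times> 1\<close> grid, whose only cell is isolated.
\<close>

lemma star_cover_exists:
  assumes "finite A" "finite B" "1 \<le> card A" "card A \<le> card B" "2 \<le> card B"
  shows "star_cover A B (max (card B) ((2 * (card A + card B) + 2) div 3))"
proof -
  define p q where "p = card A" and "q = card B"
  have bounds: "1 \<le> p" "p \<le> q" "2 \<le> q" using assms by (auto simp: p_def q_def)
  have "\<exists>i j k l. p = i + 2 * j + k \<and> q = 2 * i + j + l \<and> i + j \<ge> 1
      \<and> max q ((2 * (p + q) + 2) div 3) = 2 * i + 2 * j + k + l"
  proof (cases "2 * p \<le> q")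
    case True
    then show ?thesis using bounds
      by (intro exI[of _ p] exI[of _ 0] exI[of _ "q - 2 * p"]) auto
  next
    case False
    define c where "c = (p + q) div 3"
    consider "p + q = 3 * c" | "p + q = 3 * c + 1" | "p + q = 3 * c + 2"
      unfolding c_def by linarith
    then show ?thesis
    proof cases
      case 1
      then have "c \<le> q" "c \<le> p" using bounds False by linarith+
      then obtain i j where ij: "q = c + i" "p = c + j" by (metis le_iff_add)
      have "c = i + j" using 1 ij by linarith
      then have "p = i + 2 * j + 0" "q = 2 * i + j + 0" "i + j \<ge> 1"
        "max q ((2 * (p + q) + 2) div 3) = 2 * i + 2 * j + 0 + 0"
        using ij bounds False by (linarith | simp add: max_def)+
      then show ?thesis by blast
    next
      case 2
      then have "c + 1 \<le> q" "c \<le> p" using bounds False by linarith+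
      then obtain i j where ij: "q = c + 1 + i" "p = c + j" by (metis le_iff_add)
      have "c = i + j" using 2 ij by linarith
      then have "p = i + 2 * j + 0" "q = 2 * i + j + 1" "i + j \<ge> 1"
        "max q ((2 * (p + q) + 2) div 3) = 2 * i + 2 * j + 0 + 1"
        using ij bounds False by (linarith | simp add: max_def)+
      then show ?thesis by blast
    next
      case 3
      then have "c + 1 \<le> q" "c + 1 \<le> p" using bounds False by linarith+
      then obtain i j where ij: "q = c + 1 + i" "p = c + 1 + j" by (metis le_iff_add)
      have "c = i + j" using 3 ij by linarith
      then have "p = i + 2 * j + 1" "q = 2 * i + j + 1" "i + j \<ge> 1"
        "max q ((2 * (p + q) + 2) div 3) = 2 * i + 2 * j + 1 + 1"
        using ij bounds False by (linarith | simp add: max_def)+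
      then show ?thesis by blast
    qed
  qed
  then show ?thesis
    using star_cover_stars_rows_columns[OF assms(1,2)] unfolding p_def q_def by metis
qed

section \<open>The metric dimension\<close>

context complete_product
begin

lemma metric_generator_exists:
  assumes "r \<le> t"
  shows "\<exists>S. metric_generator P S \<and> card S = max (t - 1) (2 * (r + t - 1) div 3)"
proof -
  obtain g h where gh: "g \<in> R" "h \<in> C" using other_row other_column by meson
  have cards: "card (R - {g}) = r - 1" "card (C - {h}) = t - 1"
    using gh card_R card_C finite_R finite_C by auto
  have "star_cover (R - {g}) (C - {h}) (max (t - 1) ((2 * (r - 1 + (t - 1)) + 2) div 3))"
    using star_cover_exists[of "R - {g}" "C - {h}"] finite_R finite_C r_ge_2 t_ge_3 assms
    by (simp add: cards)
  moreover have "2 * (r - 1 + (t - 1)) + 2 = 2 * (r + t - 1)" using r_ge_2 t_ge_3 by simp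
  ultimately obtain S where S: "fst ` S = R - {g}" "snd ` S = C - {h}"
    "card S = max (t - 1) (2 * (r + t - 1) div 3)" "\<And>e. \<not> isolated_cell S e"
    unfolding star_cover_def by metis
  have "S \<subseteq> fst ` S \<times> snd ` S" by force
  then have "locating R C S" using S unfolding locating_def by auto
  with S show ?thesis using locating_imp_metric_generator by blast
qed

text \<open>
  Only the bound \<open>t - 1\<close> is available for \<open>r = 2\<close>, but then \<open>2 (t + 1) div 3 \<le> t - 1\<close> because \<open>t \<ge> 3\<close>.
\<close>

theorem metric_dim_complete_product:
  assumes "r \<le> t"
  shows "metric_dim P = max (t - 1) (2 * (r + t - 1) div 3)"
  unfolding metric_dim_def
proof (rule Least_equality)
  show "\<exists>S. metric_generator P S \<and> card S = max (t - 1) (2 * (r + t - 1) div 3)"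
    by (rule metric_generator_exists[OF assms])
next
  fix n
  assume "\<exists>S. metric_generator P S \<and> card S = n"
  then have "t - 1 \<le> n" "r \<ge> 3 \<Longrightarrow> 2 * (r + t) \<le> 3 * n + 4"
    using metric_generator_card_ge by blast+
  then show "max (t - 1) (2 * (r + t - 1) div 3) \<le> n"
    using r_ge_2 t_ge_3 by (cases "r \<ge> 3") auto
qed

end

theorem theorem2:
  fixes G :: "'a pair_pre_digraph" and H :: "'b pair_pre_digraph"
    and r t a :: nat and r' t' :: int
  assumes "K\<^bsub>r\<^esub> (with_proj G)" and "K\<^bsub>t\<^esub> (with_proj H)"
    and "r \<ge> 2" and "t \<ge> 3" and "t \<ge> r"
    and "a = (LEAST k::nat. int r - 3 * int k \<le> (int t - 3 * int k) div 2 + 1)"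
    and "r' = int r - 3 * int a" and "t' = int t - 3 * int a"
  shows "(r' < t' div 2 + 1 \<or> (r' = (t' - 1) div 2 + 1 \<and> odd t')
            \<longrightarrow> metric_dim (direct_product G H) = t + a - 1)
       \<and> (r' = t' div 2 + 1 \<and> even t'
            \<longrightarrow> metric_dim (direct_product G H) = t + a)"
proof -
  interpret complete_product G H r t using assms by unfold_locales
  let ?ok = "\<lambda>k::nat. int r - 3 * int k \<le> (int t - 3 * int k) div 2 + 1"
  have ok_iff: "?ok k \<longleftrightarrow> 2 * r \<le> t + 2 + 3 * k" for k by linarith
  \<comment> \<open>The candidate \<open>r\<close> shows that the minimum is attained.\<close>
  have "?ok r" unfolding ok_iff by simp
  then have "?ok a" unfolding assms(6) by (rule LeastI)
  then have upper: "2 * r \<le> t + 2 + 3 * a" by (simp only: ok_iff)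
  \<comment> \<open>Minimality of \<open>a\<close>, in the form that bounds \<open>2 (r + t - 1) div 3\<close> from below.\<close>
  have lower: "t + 3 * a < 2 * r + 1" if "a > 0"
  proof -
    have "\<not> ?ok (a - 1)"
      using not_less_Least[of "a - 1" ?ok] that unfolding assms(6)[symmetric] by simp
    then show ?thesis using that unfolding ok_iff by linarith
  qed
  have dim: "metric_dim P = max (t - 1) (2 * (r + t - 1) div 3)"
    using metric_dim_complete_product assms by simp
  show ?thesis
  proof (intro conjI impI)
    assume "r' < t' div 2 + 1 \<or> (r' = (t' - 1) div 2 + 1 \<and> odd t')"
    then have "2 * r' < t' + 2" by (auto elim!: oddE)
    then have "2 * r < t + 2 + 3 * a" using assms by linarith
    then have "2 * (r + t - 1) div 3 \<le> t + a - 1" using \<open>t \<ge> 3\<close> by linarith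
    moreover have "t + a - 1 \<le> 2 * (r + t - 1) div 3" if "a > 0" using lower[OF that] by linarith
    ultimately show "metric_dim P = t + a - 1" unfolding dim by (cases "a > 0") auto
  next
    assume "r' = t' div 2 + 1 \<and> even t'"
    then have "2 * r' = t' + 2" by auto
    then have "2 * r = t + 2 + 3 * a" using assms by linarith
    then have "2 * (r + t - 1) div 3 = t + a" using \<open>t \<ge> 3\<close> by linarith
    then show "metric_dim P = t + a" unfolding dim by simp
  qed
qed

end
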